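(* Let $m,n\ge 1$ be integers and let $r$ be an integer such that $\gcd(m,n)=\gcd(m,r-1)=1$ and $r^n\equiv 1\pmod m$. Let $\mathrm{ZM}(m,n,r)=\langle a,b\mid a^m=b^n=1,\ b^{-1}ab=a^r\rangle$. Then the normal subgroup lattice $N(\mathrm{ZM}(m,n,r))$ is a chain if and only if one of the following holds: (i) $m=1$ and $n$ is a prime power; or (ii) both $m$ and $n$ are prime powers and $\gcd(m,r^k-1)=1$ for all integers $k$ with $1\le k<n$.
   Context: For a group $G$, $N(G)$ denotes the lattice of all normal subgroups of $G$, ordered by inclusion; it is a chain if any two normal subgroups of $G$ are comparable under inclusion. The group $\mathrm{ZM}(m,n,r)$ (a ZM-group, i.e. a finite group all of whose Sylow subgroups are cyclic) has order $mn$. A prime power is an integer of the form $p^v$ with $p$ prime and $v\ge 0$ an integer (so $1$ counts as a prime power). *)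

theory Defs
  imports "HOL-Algebra.Coset" "HOL-Computational_Algebra.Primes" "HOL-Number_Theory.Cong"
begin

text \<open>
  A word over a set of generators: the letter \<open>(x, True)\<close> stands for the generator \<open>x\<close> and
  \<open>(x, False)\<close> for its formal inverse.
\<close>

type_synonym 'g word = "('g \<times> bool) list"

text \<open>
  The congruence on words imposed by a set \<open>E\<close> of defining equations: the least one that
  contains \<open>E\<close> and the cancellation laws of the free group.
\<close>

inductive_set pres_rel :: "('g word \<times> 'g word) set \<Rightarrow> ('g word \<times> 'g word) set"
  for E :: "('g word \<times> 'g word) set" where
  pres_refl: "(u, u) \<in> pres_rel E"
| pres_sym: "(u, v) \<in> pres_rel E \<Longrightarrow> (v, u) \<in> pres_rel E"
| pres_trans: "(u, v) \<in> pres_rel E \<Longrightarrow> (v, w) \<in> pres_rel E \<Longrightarrow> (u, w) \<in> pres_rel E"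
| pres_cancel: "(u @ [(x, e), (x, \<not> e)] @ v, u @ v) \<in> pres_rel E"
| pres_eqn: "(s, t) \<in> E \<Longrightarrow> (u @ s @ v, u @ t @ v) \<in> pres_rel E"

text \<open>
  The group presented by all elements of the type \<open>'g\<close> as generators, subject to the
  equations \<open>E\<close>.
\<close>

definition presented_group :: "('g word \<times> 'g word) set \<Rightarrow> 'g word set monoid" where
  "presented_group E =
    \<lparr>carrier = UNIV // pres_rel E,
     monoid.mult = (\<lambda>A B. \<Union>u\<in>A. \<Union>v\<in>B. pres_rel E `` {u @ v}),
     one = pres_rel E `` {[]}\<rparr>"

definition gen_pow :: "'g \<Rightarrow> int \<Rightarrow> 'g word" where
  "gen_pow x k = replicate (nat \<bar>k\<bar>) (x, 0 \<le> k)"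

datatype zm_gen = Gen_a | Gen_b

definition ZM :: "nat \<Rightarrow> nat \<Rightarrow> int \<Rightarrow> zm_gen word set monoid" where
  "ZM m n r = presented_group
    {(gen_pow Gen_a (int m), []),
     (gen_pow Gen_b (int n), []),
     (gen_pow Gen_b (- 1) @ gen_pow Gen_a 1 @ gen_pow Gen_b 1, gen_pow Gen_a r)}"

definition normal_subgroups :: "('a, 'b) monoid_scheme \<Rightarrow> 'a set set" where
  "normal_subgroups G = {N. N \<lhd> G}"

text \<open>
  In contrast to the library's \<open>primepow\<close>, the exponent may be zero, so that \<open>1\<close> is included.
\<close>

definition is_prime_power :: "nat \<Rightarrow> bool" where
  "is_prime_power q \<longleftrightarrow> (\<exists>p v. prime p \<and> q = p ^ v)"

lemma equiv_pres_rel: "equiv UNIV (pres_rel E)"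
  by (auto intro!: equivI refl_onI symI transI intro: pres_rel.intros(1-3))

lemma pres_rel_context:
  assumes "(u, v) \<in> pres_rel E"
  shows "(x @ u @ y, x @ v @ y) \<in> pres_rel E"
  using assms
proof induction
  case (pres_cancel u z e v)
  show ?case
    using pres_rel.pres_cancel[of "x @ u" z e "v @ y" E] by simp
next
  case (pres_eqn s t u v)
  then show ?case
    using pres_rel.pres_eqn[of s t E "x @ u" "v @ y"] by simp
qed (auto intro: pres_rel.intros(1-3))

lemma pres_rel_append:
  assumes "(u, u') \<in> pres_rel E" "(v, v') \<in> pres_rel E"
  shows "(u @ v, u' @ v') \<in> pres_rel E"
  using pres_rel_context[OF assms(1), of "[]" v] pres_rel_context[OF assms(2), of u' "[]"]
  by (auto intro: pres_trans)

lemma presented_group_mult: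
  "pres_rel E `` {u} \<otimes>\<^bsub>presented_group E\<^esub> pres_rel E `` {v} = pres_rel E `` {u @ v}"
proof -
  have "congruent2 (pres_rel E) (pres_rel E) (\<lambda>u v. pres_rel E `` {u @ v})"
    by (auto simp: congruent2_def intro!: equiv_class_eq[OF equiv_pres_rel] pres_rel_append)
  then show ?thesis
    by (simp add: presented_group_def UN_equiv_class2[OF equiv_pres_rel equiv_pres_rel])
qed

lemma pres_rel_left_inverse:
  "(map (\<lambda>(x, e). (x, \<not> e)) (rev u) @ u, []) \<in> pres_rel E"
proof (induction u)
  case Nil
  show ?case by (simp add: pres_refl)
next
  case (Cons l u)
  obtain x e where l: "l = (x, e)" by fastforce
  show ?case
    using pres_cancel[of "map (\<lambda>(x, e). (x, \<not> e)) (rev u)" x "\<not> e" u E] Cons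
    by (auto simp: l intro: pres_trans)
qed

lemma group_presented_group: "group (presented_group E)"
proof (rule groupI)
  have carr: "\<exists>u. A = pres_rel E `` {u}" if "A \<in> carrier (presented_group E)" for A
    using that by (auto simp: presented_group_def elim: quotientE)
  have cls: "pres_rel E `` {u} \<in> carrier (presented_group E)" for u
    by (simp add: presented_group_def quotientI)
  have one: "\<one>\<^bsub>presented_group E\<^esub> = pres_rel E `` {[]}"
    by (simp add: presented_group_def)
  show "\<one>\<^bsub>presented_group E\<^esub> \<in> carrier (presented_group E)"
    by (simp add: one cls)
  show "A \<otimes>\<^bsub>presented_group E\<^esub> B \<in> carrier (presented_group E)"
    if "A \<in> carrier (presented_group E)" "B \<in> carrier (presented_group E)" for A B
    using carr[OF that(1)] carr[OF that(2)] by (auto simp: presented_group_mult cls)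
  show "A \<otimes>\<^bsub>presented_group E\<^esub> B \<otimes>\<^bsub>presented_group E\<^esub> C =
        A \<otimes>\<^bsub>presented_group E\<^esub> (B \<otimes>\<^bsub>presented_group E\<^esub> C)"
    if "A \<in> carrier (presented_group E)" "B \<in> carrier (presented_group E)"
      "C \<in> carrier (presented_group E)" for A B C
    using carr[OF that(1)] carr[OF that(2)] carr[OF that(3)] by (auto simp: presented_group_mult)
  show "\<one>\<^bsub>presented_group E\<^esub> \<otimes>\<^bsub>presented_group E\<^esub> A = A"
    if "A \<in> carrier (presented_group E)" for A
    using carr[OF that] by (auto simp: presented_group_mult one)
  show "\<exists>B\<in>carrier (presented_group E). B \<otimes>\<^bsub>presented_group E\<^esub> A = \<one>\<^bsub>presented_group E\<^esub>"
    if A: "A \<in> carrier (presented_group E)" for A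
  proof -
    obtain u where u: "A = pres_rel E `` {u}" using carr[OF A] by blast
    show ?thesis
      by (rule bexI[OF _ cls[of "map (\<lambda>(x, e). (x, \<not> e)) (rev u)"]])
        (simp add: u one presented_group_mult equiv_class_eq[OF equiv_pres_rel pres_rel_left_inverse])
  qed
qed

end

theory Submission imports Defs begin

text \<open>
  Sending the word \<open>b\<^sup>j a\<^sup>i\<close> to \<open>(j, i)\<close> identifies \<open>ZM(m,n,r)\<close> with the semidirect product with
  \<open>(b\<^sup>j a\<^sup>i) (b\<^sup>l a\<^sup>k) = b\<^sup>j\<^sup>+\<^sup>l a\<^sup>s\<close>, \<open>s = i r\<^sup>l + k\<close>, where \<open>j\<close> counts modulo \<open>n\<close> and \<open>i\<close> modulo \<open>m\<close>.
  The elements with \<open>d | j\<close> and \<open>e | i\<close> form a normal subgroup whenever \<open>d | n\<close>, \<open>e | m\<close> and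
  \<open>r\<^sup>d \<equiv> 1 (mod e)\<close>. If the normal subgroups form a chain, then the cases \<open>d = n\<close> and \<open>e = 1\<close> show that
  the divisors of \<open>m\<close> and those of \<open>n\<close> form chains, so that \<open>m = p\<^sup>u\<close> and \<open>n\<close> are prime powers; and if
  \<open>p\<close> divides \<open>r\<^sup>k - 1\<close> with \<open>1 \<le> k < n\<close>, then \<open>r\<^sup>d \<equiv> 1 (mod m)\<close> for \<open>d = gcd k n\<close>, so that
  \<open>\<langle>b\<^sup>d\<rangle>\<close> is normal, and it is incomparable with \<open>\<langle>a\<rangle>\<close>. Conversely, under (ii) a normal subgroup that contains
  \<open>b\<^sup>j a\<^sup>i\<close> with \<open>n\<close> not dividing \<open>j\<close> contains \<open>\<langle>a\<rangle>\<close> because \<open>r\<^sup>j - 1\<close> is invertible modulo \<open>m\<close>, and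
  subgroups of cyclic groups of prime power order are comparable.
\<close>

subsection \<open>Prime powers and congruences\<close>

text \<open>Split off the full power of one prime \<open>p\<close>. The cofactor \<open>k\<close> is
  comparable with \<open>p\<close> but not divisible by it, so \<open>k dvd p\<close> and hence
  \<open>k = 1\<close>.\<close>

lemma is_prime_powerI_divisors_chain:
  assumes "n \<ge> 1"
    and chain: "\<And>d e. d dvd n \<Longrightarrow> e dvd n \<Longrightarrow> d dvd e \<or> e dvd d"
  shows "is_prime_power n"
proof (cases "n = 1")
  case True
  then show ?thesis
    unfolding is_prime_power_def by (metis power_0 two_is_prime_nat)
next
  case False
  then obtain p where p: "prime p" "p dvd n"
    using prime_factor_nat by blast
  obtain v k where n: "n = p ^ v * k" and k: "\<not> p dvd k"
    using prime_power_canonical[OF p(1), of n] \<open>n \<ge> 1\<close> by (auto simp: mult.commute)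
  have "k dvd p"
    using chain[of p k] p k by (auto simp: n)
  then have "k = 1"
    using p(1) k by (metis prime_nat_iff)
  then show ?thesis
    using p n by (auto simp: is_prime_power_def)
qed

text \<open>The gcds of \<open>i\<close> and \<open>j\<close> with \<open>q\<close> are powers of
  the same prime, so one divides the other, which makes the linear congruence solvable in one
  direction. This compares cyclic subgroups of Z/q.\<close>

lemma prime_power_cong_multiple:
  fixes i j :: int
  assumes "is_prime_power q"
  obtains c :: nat where "[j = int c * i] (mod int q)"
  | c :: nat where "[i = int c * j] (mod int q)"
proof -
  obtain p v where p: "prime p" and q: "q = p ^ v"
    using assms by (auto simp: is_prime_power_def)
  have q0: "q > 0" using p q by (simp add: prime_gt_0_nat)
  have pw: "\<exists>s. gcd x (int q) = int p ^ s" for x :: int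
  proof -
    have "nat (gcd x (int q)) dvd p ^ v"
      by (metis gcd_dvd2 nat_dvd_iff q gcd_ge_0_int)
    then obtain s where "nat (gcd x (int q)) = p ^ s"
      using divides_primepow_nat[OF p] by blast
    then have "gcd x (int q) = int p ^ s"
      by (metis gcd_ge_0_int int_nat_eq of_nat_power)
    then show ?thesis ..
  qed
  have mult: "\<exists>c::nat. [y = int c * x] (mod int q)"
    if "gcd x (int q) dvd gcd y (int q)" for x y :: int
  proof -
    obtain d where d: "[x * d = gcd x (int q)] (mod int q)"
      using cong_solve_int by blast
    have "gcd x (int q) dvd y"
      using that by simp
    then obtain e where e: "y = gcd x (int q) * e"
      by (elim dvdE)
    have "[x * d * e = y] (mod int q)"
      using cong_scalar_right[OF d, of e] by (simp only: e[symmetric])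
    then have "[y = (d * e) * x] (mod int q)"
      by (simp add: mult_ac cong_sym_eq)
    \<comment> \<open>Reducing modulo \<open>q\<close> makes the coefficient nonnegative, so that it
      can later count factors in a product.\<close>
    also have "[(d * e) * x = (d * e mod int q) * x] (mod int q)"
      by (intro cong_mult) auto
    finally have "[y = int (nat (d * e mod int q)) * x] (mod int q)"
      using q0 by simp
    then show ?thesis ..
  qed
  obtain s t where s: "gcd i (int q) = int p ^ s" and t: "gcd j (int q) = int p ^ t"
    using pw by blast
  show ?thesis
  proof (cases "s \<le> t")
    case True
    then show ?thesis using mult[of i j] s t that(1) le_imp_power_dvd by metis
  next
    case False
    then show ?thesis using mult[of j i] s t that(2) le_imp_power_dvd nat_le_linear by metis
  qed
qed

lemma cong_power_exponent:
  fixes r M :: int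
  assumes "[r ^ n = 1] (mod M)" and "[j = l] (mod n)"
  shows "[r ^ j = r ^ l] (mod M)"
proof -
  have red: "[r ^ x = r ^ (x mod n)] (mod M)" for x
  proof -
    have "r ^ x = (r ^ n) ^ (x div n) * r ^ (x mod n)"
      by (metis mult_div_mod_eq power_add power_mult)
    also have "[\<dots> = 1 ^ (x div n) * r ^ (x mod n)] (mod M)"
      by (intro cong_mult cong_pow assms(1) cong_refl)
    finally show ?thesis by simp
  qed
  show ?thesis
    using red[of j] red[of l] assms(2) by (metis cong_def)
qed

text \<open>Factor \<open>t ^ N - 1\<close> as \<open>t - 1\<close> times a geometric sum. Modulo
  \<open>p\<close> the sum is \<open>N\<close>, so it is coprime to \<open>p ^ u\<close> and can be
  cancelled.\<close>

lemma cong_one_lift_prime_power: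
  fixes t :: int
  assumes "prime p" and "\<not> p dvd N"
    and tp: "[t = 1] (mod int p)" and tN: "[t ^ N = 1] (mod int (p ^ u))"
  shows "[t = 1] (mod int (p ^ u))"
proof -
  have "[(\<Sum>i<N. t ^ i) = (\<Sum>i<N. 1 ^ i)] (mod int p)"
    by (intro cong_sum cong_pow tp)
  then have "\<not> int p dvd (\<Sum>i<N. t ^ i)"
    using assms(2) by (auto simp: cong_dvd_iff)
  then have "coprime (int (p ^ u)) (\<Sum>i<N. t ^ i)"
    using assms(1) by (auto intro!: prime_imp_coprime coprime_power_left_iff[THEN iffD2])
  moreover have "int (p ^ u) dvd (t - 1) * (\<Sum>i<N. t ^ i)"
    using tN by (simp add: cong_iff_dvd_diff power_diff_1_eq)
  ultimately show ?thesis
    by (simp add: cong_iff_dvd_diff coprime_dvd_mult_left_iff)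
qed

text \<open>Modulo \<open>p\<close> the claim is Bezout's identity in the exponents. It lifts to
  \<open>p ^ u\<close> because the cofactor \<open>n div gcd k n\<close> is prime to
  \<open>p\<close>.\<close>

lemma power_gcd_cong_one:
  fixes r :: int
  assumes p: "prime p" and "coprime (p ^ u) n" "u > 0" "n > 0" "k > 0"
    and rk: "[r ^ k = 1] (mod int p)" and rn: "[r ^ n = 1] (mod int (p ^ u))"
  shows "[r ^ gcd k n = 1] (mod int (p ^ u))"
proof (rule cong_one_lift_prime_power[OF p])
  have "coprime p n" using assms by auto
  then have "\<not> p dvd n"
    using p by (metis coprime_absorb_left not_prime_unit)
  then show "\<not> p dvd n div gcd k n"
    by (metis dvd_mult dvd_mult_div_cancel gcd_dvd2)
  have rp: "[r ^ n = 1] (mod int p)"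
    using rn by (rule cong_dvd_modulus) (use \<open>u > 0\<close> in auto)
  obtain x y where xy: "k * x = n * y + gcd k n"
    using bezout_nat[of k n] \<open>k > 0\<close> by auto
  have "[1 ^ x = (r ^ k) ^ x] (mod int p)"
    by (intro cong_pow cong_sym[OF rk])
  also have "(r ^ k) ^ x = (r ^ n) ^ y * r ^ gcd k n"
    by (metis power_add power_mult xy)
  also have "[\<dots> = 1 ^ y * r ^ gcd k n] (mod int p)"
    by (intro cong_mult cong_pow rp cong_refl)
  finally show "[r ^ gcd k n = 1] (mod int p)"
    by (simp add: cong_sym)
  show "[(r ^ gcd k n) ^ (n div gcd k n) = 1] (mod int (p ^ u))"
    using rn by (simp flip: power_mult)
qed

subsection \<open>Normal subgroups of a metacyclic group in normal form\<close>

text \<open>\<open>E j i\<close> stands for \<open>b\<^sup>j a\<^sup>i\<close>.\<close>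

locale zm_group = group G for G (structure) +
  fixes m n :: nat and r :: int and E :: "nat \<Rightarrow> int \<Rightarrow> 'a"
  assumes m_pos: "m \<ge> 1" and n_pos: "n \<ge> 1"
    and coprime_mn: "coprime m n"
    and power_r: "[r ^ n = 1] (mod int m)"
    and carrier_eq: "carrier G = {E j i | j i. True}"
    and E_eq_iff: "E j i = E l k \<longleftrightarrow> [j = l] (mod n) \<and> [i = k] (mod int m)"
    and E_mult: "E j i \<otimes> E l k = E (j + l) (i * r ^ l + k)"
begin

lemma E_closed [simp]: "E j i \<in> carrier G"
  by (auto simp: carrier_eq)

lemma one_eq: "\<one> = E 0 0"
proof -
  have "E 0 0 \<otimes> E 0 0 = E 0 0"
    by (simp add: E_mult)
  then show ?thesis
    by (metis E_closed l_cancel_one)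
qed

lemma E_inverse:
  obtains l k where "inv (E j i) = E l k" "[j + l = 0] (mod n)" "[i * r ^ l + k = 0] (mod int m)"
proof -
  obtain l k where lk: "inv (E j i) = E l k"
    using inv_closed[OF E_closed[of j i]] by (auto simp: carrier_eq)
  have "E (j + l) (i * r ^ l + k) = E 0 0"
    using r_inv[OF E_closed[of j i]] by (simp add: lk E_mult one_eq)
  then show ?thesis
    using that[OF lk] by (simp add: E_eq_iff)
qed

section \<open>Normal subgroups attached to pairs of divisors\<close>

definition exponent_subgroup :: "nat \<Rightarrow> nat \<Rightarrow> 'a set" where
  "exponent_subgroup d e = {E j i | j i. d dvd j \<and> int e dvd i}"

lemma E_in_exponent_subgroup: "d dvd j \<Longrightarrow> int e dvd i \<Longrightarrow> E j i \<in> exponent_subgroup d e"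
  by (auto simp: exponent_subgroup_def)

text \<open>\<open>E\<close> determines its exponents only modulo \<open>n\<close> and
  \<open>m\<close>; divisibility by divisors of these moduli does not depend on the
  representatives.\<close>

lemma E_in_exponent_subgroup_iff:
  assumes "d dvd n" "e dvd m"
  shows "E j i \<in> exponent_subgroup d e \<longleftrightarrow> d dvd j \<and> int e dvd i"
proof
  assume "E j i \<in> exponent_subgroup d e"
  then obtain l k where lk: "[j = l] (mod n)" "[i = k] (mod int m)" "d dvd l" "int e dvd k"
    by (auto simp: exponent_subgroup_def E_eq_iff)
  have "[j = l] (mod d)" "[i = k] (mod int e)"
    using cong_dvd_modulus_nat[OF lk(1)] cong_dvd_modulus[OF lk(2)] assms by simp_all
  then show "d dvd j \<and> int e dvd i"
    using lk(3,4) by (simp add: cong_dvd_iff)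
qed (simp add: E_in_exponent_subgroup)

lemma exponent_subgroup_normal:
  assumes d: "d dvd n" and e: "e dvd m" and rd: "[r ^ d = 1] (mod int e)"
  shows "exponent_subgroup d e \<lhd> G"
proof -
  have modd: "d dvd j \<longleftrightarrow> d dvd l" if "[j = l] (mod n)" for j l
    using cong_dvd_modulus_nat[OF that d] by (rule cong_dvd_iff)
  have mode: "[j = l] (mod int e)" if "[j = l] (mod int m)" for j l
    using that e by (auto intro: cong_dvd_modulus)
  have mem: "E j i \<in> exponent_subgroup d e \<longleftrightarrow> d dvd j \<and> int e dvd i" for j i
    using E_in_exponent_subgroup_iff[OF d e] .
  have "subgroup (exponent_subgroup d e) G"
  proof (rule subgroupI)
    show "exponent_subgroup d e \<subseteq> carrier G" by (auto simp: exponent_subgroup_def)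
    show "exponent_subgroup d e \<noteq> {}" by (auto simp: exponent_subgroup_def)
    show "inv x \<in> exponent_subgroup d e" if x: "x \<in> exponent_subgroup d e" for x
    proof -
      obtain j i where ji: "x = E j i" "d dvd j" "int e dvd i"
        using x by (auto simp: exponent_subgroup_def)
      obtain l k where lk: "inv (E j i) = E l k" "[j + l = 0] (mod n)" "[i * r ^ l + k = 0] (mod int m)"
        by (rule E_inverse)
      have "d dvd l"
        using modd[OF lk(2)] ji by (simp add: dvd_add_right_iff)
      moreover have "int e dvd k"
        using mode[OF lk(3)] ji by (simp add: cong_0_iff dvd_add_right_iff)
      ultimately show ?thesis by (simp add: ji lk mem)
    qed
    show "x \<otimes> y \<in> exponent_subgroup d e" if "x \<in> exponent_subgroup d e" "y \<in> exponent_subgroup d e" for x y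
    proof -
      obtain j i where "x = E j i" "d dvd j" "int e dvd i"
        using \<open>x \<in> exponent_subgroup d e\<close> by (auto simp: exponent_subgroup_def)
      moreover obtain l k where "y = E l k" "d dvd l" "int e dvd k"
        using \<open>y \<in> exponent_subgroup d e\<close> by (auto simp: exponent_subgroup_def)
      ultimately show ?thesis
        by (simp add: E_mult E_in_exponent_subgroup)
    qed
  qed
  moreover have "x \<otimes> h \<otimes> inv x \<in> exponent_subgroup d e" if x: "x \<in> carrier G" and h: "h \<in> exponent_subgroup d e" for x h
  proof -
    obtain s t where st: "x = E s t" using x by (auto simp: carrier_eq)
    obtain j i where ji: "h = E j i" "d dvd j" "int e dvd i"
      using h by (auto simp: exponent_subgroup_def)
    obtain l k where lk: "inv (E s t) = E l k" "[s + l = 0] (mod n)" "[t * r ^ l + k = 0] (mod int m)"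
      by (rule E_inverse)
    have "d dvd s + j + l"
      using modd[OF lk(2)] ji(2) by (metis add.assoc add.commute dvd_0_right dvd_add)
    \<comment> \<open>Modulo \<open>e\<close> the factor \<open>h\<close> leaves no trace, since
      \<open>r ^ j\<close> is 1 and \<open>i\<close> is 0 there; what remains is the exponent of
      \<open>x\<close> times its inverse.\<close>
    moreover have "int e dvd (t * r ^ j + i) * r ^ l + k"
    proof -
      have "[r ^ j = r ^ 0] (mod int e)"
        using rd ji(2) by (intro cong_power_exponent) (auto simp: cong_0_iff)
      then have "[(t * r ^ j + i) * r ^ l + k = (t * 1 + 0) * r ^ l + k] (mod int e)"
        using ji(3) by (intro cong_add cong_mult cong_refl) (auto simp: cong_0_iff)
      also have "[(t * 1 + 0) * r ^ l + k = 0] (mod int e)"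
        using mode[OF lk(3)] by simp
      finally show ?thesis by (simp add: cong_0_iff)
    qed
    ultimately show ?thesis
      by (simp add: st ji lk E_mult mem)
  qed
  ultimately show ?thesis
    by (simp add: normal_inv_iff)
qed

section \<open>Necessity of the arithmetic conditions\<close>

text \<open>Testing an inclusion on the single element \<open>E d (int e)\<close> shows that it
  forces reverse divisibility in both parameters.\<close>

lemma chain_exponents_comparable:
  assumes "chain\<^sub>\<subseteq> (normal_subgroups G)"
    and "d dvd n" "e dvd m" "[r ^ d = 1] (mod int e)"
    and "d' dvd n" "e' dvd m" "[r ^ d' = 1] (mod int e')"
  shows "d' dvd d \<and> e' dvd e \<or> d dvd d' \<and> e dvd e'"
proof -
  have sub: "d2 dvd d1 \<and> e2 dvd e1"
    if "exponent_subgroup d1 e1 \<subseteq> exponent_subgroup d2 e2" "d2 dvd n" "e2 dvd m" for d1 d2 e1 e2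
  proof -
    have "E d1 (int e1) \<in> exponent_subgroup d1 e1"
      by (simp add: E_in_exponent_subgroup)
    then show ?thesis
      using that E_in_exponent_subgroup_iff by auto
  qed
  have "exponent_subgroup d e \<in> normal_subgroups G" "exponent_subgroup d' e' \<in> normal_subgroups G"
    using assms by (auto simp: normal_subgroups_def exponent_subgroup_normal)
  then have "exponent_subgroup d e \<subseteq> exponent_subgroup d' e' \<or> exponent_subgroup d' e' \<subseteq> exponent_subgroup d e"
    using assms(1) by (auto simp: chain_subset_def)
  then show ?thesis
    using sub assms by metis
qed

lemma prime_powers_if_chain:
  assumes "chain\<^sub>\<subseteq> (normal_subgroups G)"
  shows "is_prime_power m" "is_prime_power n"
proof -
  show "is_prime_power m"
  proof (rule is_prime_powerI_divisors_chain[OF m_pos])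
    fix d e assume "d dvd m" "e dvd m"
    moreover from this have "[r ^ n = 1] (mod int d)" "[r ^ n = 1] (mod int e)"
      using power_r by (auto intro: cong_dvd_modulus)
    ultimately show "d dvd e \<or> e dvd d"
      using chain_exponents_comparable[OF assms, of n d n e] by auto
  qed
  show "is_prime_power n"
    using chain_exponents_comparable[OF assms, of _ 1 _ 1]
    by (intro is_prime_powerI_divisors_chain[OF n_pos]) auto
qed

lemma coprime_if_chain:
  assumes chain: "chain\<^sub>\<subseteq> (normal_subgroups G)" and k: "1 \<le> k" "k < n"
  shows "coprime (int m) (r ^ k - 1)"
proof (rule ccontr)
  assume nc: "\<not> coprime (int m) (r ^ k - 1)"
  obtain p u where p: "prime p" and m: "m = p ^ u"
    using prime_powers_if_chain(1)[OF chain] by (auto simp: is_prime_power_def)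
  have u: "u > 0"
    using nc by (auto simp: m intro: Nat.gr0I)
  have "\<not> coprime (int p) (r ^ k - 1)"
    using nc by (auto simp: m)
  then have "int p dvd r ^ k - 1"
    using p prime_imp_coprime by (metis prime_nat_int_transfer)
  then have "[r ^ gcd k n = 1] (mod int (p ^ u))"
    using power_gcd_cong_one[OF p, of u n k r] u k coprime_mn power_r
    by (simp add: m cong_iff_dvd_diff)
  \<comment> \<open>The pair \<open>(gcd k n, m)\<close> gives the subgroup generated by a power of
    \<open>b\<close>, and \<open>(n, 1)\<close> gives the one generated by \<open>a\<close>.\<close>
  then have "n dvd gcd k n \<or> m dvd 1"
    using chain_exponents_comparable[OF chain, of "gcd k n" m n 1] by (auto simp: m)
  moreover have "\<not> n dvd gcd k n"
    using k by (auto dest: dvd_imp_le)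
  moreover have "\<not> m dvd 1"
    using p u by (simp add: m prime_nat_iff)
  ultimately show False by blast
qed

section \<open>Sufficiency of the arithmetic conditions\<close>

text \<open>Conjugation by \<open>a^c\<close> adds \<open>c * (r ^ j - 1)\<close> to the exponent of
  \<open>a\<close>. As \<open>r ^ j - 1\<close> is invertible modulo \<open>m\<close>, a suitable
  \<open>c\<close> reaches every \<open>k\<close>.\<close>

lemma normal_E_shift:
  assumes N: "N \<lhd> G" and x: "E j i \<in> N" and cop: "coprime (int m) (r ^ j - 1)"
  shows "E j k \<in> N"
proof -
  obtain t where t: "[(r ^ j - 1) * t = 1] (mod int m)"
    using cong_solve_coprime_int[of "r ^ j - 1" "int m"] cop by (auto simp: coprime_commute)
  define c where "c = t * (k - i)"
  have "inv (E 0 c) = E 0 (- c)"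
    by (rule inv_equality) (auto simp: E_mult one_eq)
  then have "E 0 c \<otimes> E j i \<otimes> inv (E 0 c) = E j (c * r ^ j + i - c)"
    by (simp add: E_mult)
  moreover have "\<dots> = E j k"
  proof -
    have "[(r ^ j - 1) * t * (k - i) + i = 1 * (k - i) + i] (mod int m)"
      by (intro cong_add cong_mult t cong_refl)
    then show ?thesis
      by (simp add: E_eq_iff c_def algebra_simps)
  qed
  ultimately show ?thesis
    using normal.inv_op_closed2[OF N E_closed x] by metis
qed

text \<open>It suffices to compare elements: if of any two, one lies in every normal subgroup
  containing the other, then no two normal subgroups can be incomparable.\<close>

lemma chain_if_prime_powers:
  assumes pm: "is_prime_power m" and pn: "is_prime_power n"
    and cop: "\<And>k. 1 \<le> k \<Longrightarrow> k < n \<Longrightarrow> coprime (int m) (r ^ k - 1)"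
  shows "chain\<^sub>\<subseteq> (normal_subgroups G)"
proof -
  have cop': "coprime (int m) (r ^ j - 1)" if "\<not> n dvd j" for j
  proof -
    have "[r ^ (j mod n) - 1 = r ^ j - 1] (mod int m)"
      using power_r by (intro cong_diff cong_power_exponent cong_refl) auto
    moreover have "coprime (int m) (r ^ (j mod n) - 1)"
      using that n_pos by (intro cop) (auto simp: Suc_le_eq dvd_eq_mod_eq_0)
    ultimately show ?thesis
      using cong_imp_coprime coprime_commute by blast
  qed
  have shift: "E j k \<in> N" if "N \<lhd> G" "E j i \<in> N" "\<not> n dvd j" for N j i k
    using normal_E_shift[OF that(1,2) cop'[OF that(3)]] .
  \<comment> \<open>Quotients of elements with the same \<open>b\<close>-exponent, all of which lie
    in \<open>N\<close> by \<open>shift\<close>, yield every power of \<open>a\<close>.\<close>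
  have base: "E 0 k \<in> N" if N: "N \<lhd> G" and x: "E j i \<in> N" "\<not> n dvd j" for N j i k
  proof -
    interpret N: normal N G by (rule N)
    have "inv (E j 0) \<otimes> E j k \<in> N"
      using shift[OF N x] by blast
    moreover have "inv (E j 0) \<otimes> E j k = E 0 k"
      by (simp add: inv_solve_left' E_mult)
    ultimately show ?thesis by simp
  qed
  \<comment> \<open>When one exponent vanishes, the \<open>c\<close>-th power just multiplies both
    exponents by \<open>c\<close>; no powers of \<open>r\<close> enter.\<close>
  have mult: "E (c * j) (int c * i) \<in> N" if N: "N \<lhd> G" and x: "E j i \<in> N" and "j = 0 \<or> i = 0" for N j i c
  proof -
    interpret N: normal N G by (rule N)
    show ?thesis
    proof (induction c)
      case 0
      show ?case using N.one_closed by (simp add: one_eq)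
    next
      case (Suc c)
      have "E (c * j) (int c * i) \<otimes> E j i \<in> N"
        using Suc x by blast
      then show ?case
        using that(3) by (auto simp: E_mult algebra_simps)
    qed
  qed
  \<comment> \<open>First shift to \<open>E j 0\<close>, whose \<open>c\<close>-th power supplies
    \<open>b^l\<close>; \<open>base\<close> then supplies the factor \<open>a^k\<close>.\<close>
  have multiple: "E l k \<in> N"
    if N: "N \<lhd> G" and x: "E j i \<in> N" and "\<not> n dvd j" and c: "[l = c * j] (mod n)" for N j i l k c
  proof -
    interpret N: normal N G by (rule N)
    have "E (c * j) 0 \<otimes> E 0 k \<in> N"
      using mult[OF N shift[OF N x, of 0], of c] base[OF N x] that(3) by auto
    then show ?thesis
      using c by (metis E_eq_iff E_mult add_0_right cong_refl mult_zero_left power_0 add_0)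
  qed
  have comparable: "(\<forall>N. N \<lhd> G \<longrightarrow> x \<in> N \<longrightarrow> y \<in> N) \<or> (\<forall>N. N \<lhd> G \<longrightarrow> y \<in> N \<longrightarrow> x \<in> N)"
    if xy: "x \<in> carrier G" "y \<in> carrier G" for x y
  proof -
    obtain j i l k where x: "x = E j i" and y: "y = E l k"
      using xy by (auto simp: carrier_eq)
    have E0: "E s t = E 0 t" if "n dvd s" for s t
      using that by (simp add: E_eq_iff cong_0_iff)
    \<comment> \<open>Here \<open>n dvd j\<close> means that \<open>x\<close> is a power of
      \<open>a\<close>. Two powers of \<open>a\<close> are compared through \<open>m\<close>, two
      elements that are not through \<open>n\<close>; in the mixed cases \<open>base\<close>
      decides.\<close>
    consider "n dvd j" "n dvd l" | "n dvd j" "\<not> n dvd l" | "\<not> n dvd j" "n dvd l"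
      | "\<not> n dvd j" "\<not> n dvd l"
      by blast
    then show ?thesis
    proof cases
      case 1
      have pow: "E 0 t \<in> N" if "N \<lhd> G" "E 0 s \<in> N" "[t = int c * s] (mod int m)" for N s t c
      proof -
        have "E 0 t = E (c * 0) (int c * s)"
          using that(3) by (simp add: E_eq_iff)
        then show ?thesis
          using mult[OF that(1,2)] by simp
      qed
      have x: "x = E 0 i" and y: "y = E 0 k"
        by (simp_all only: x y E0[OF 1(1)] E0[OF 1(2)])
      show ?thesis
      proof (cases rule: prime_power_cong_multiple[OF pm, where i = i and j = k])
        case (1 c)
        have "\<forall>N. N \<lhd> G \<longrightarrow> x \<in> N \<longrightarrow> y \<in> N"
          unfolding x y using pow[OF _ _ 1] by blast
        then show ?thesis ..
      next
        case (2 c)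
        have "\<forall>N. N \<lhd> G \<longrightarrow> y \<in> N \<longrightarrow> x \<in> N"
          unfolding x y using pow[OF _ _ 2] by blast
        then show ?thesis ..
      qed
    next
      case 2
      have "\<forall>N. N \<lhd> G \<longrightarrow> y \<in> N \<longrightarrow> x \<in> N"
        unfolding x y E0[OF 2(1)] using base[OF _ _ 2(2)] by blast
      then show ?thesis ..
    next
      case 3
      have "\<forall>N. N \<lhd> G \<longrightarrow> x \<in> N \<longrightarrow> y \<in> N"
        unfolding x y E0[OF 3(2)] using base[OF _ _ 3(1)] by blast
      then show ?thesis ..
    next
      case 4
      have cong: "[s = c * t] (mod n)" if "[int s = int c * int t] (mod int n)" for s c t
        using that by (simp flip: cong_int_iff)
      show ?thesis
      proof (cases rule: prime_power_cong_multiple[OF pn, where i = "int j" and j = "int l"])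
        case (1 c)
        have "\<forall>N. N \<lhd> G \<longrightarrow> x \<in> N \<longrightarrow> y \<in> N"
          unfolding x y using multiple[OF _ _ 4(1) cong[OF 1]] by blast
        then show ?thesis ..
      next
        case (2 c)
        have "\<forall>N. N \<lhd> G \<longrightarrow> y \<in> N \<longrightarrow> x \<in> N"
          unfolding x y using multiple[OF _ _ 4(2) cong[OF 2]] by blast
        then show ?thesis ..
      qed
    qed
  qed
  show ?thesis
    unfolding chain_subset_def normal_subgroups_def
  proof (intro ballI)
    fix A B assume "A \<in> {N. N \<lhd> G}" "B \<in> {N. N \<lhd> G}"
    then have A: "A \<lhd> G" and B: "B \<lhd> G" by simp_all
    show "A \<subseteq> B \<or> B \<subseteq> A"
    proof (rule ccontr)
      assume "\<not> (A \<subseteq> B \<or> B \<subseteq> A)"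
      then obtain x y where "x \<in> A" "x \<notin> B" "y \<in> B" "y \<notin> A" by blast
      moreover from this have "x \<in> carrier G" "y \<in> carrier G"
        using A B normal_imp_subgroup subgroup.mem_carrier by metis+
      ultimately show False
        using comparable[of x y] A B by metis
    qed
  qed
qed

end

subsection \<open>Normal forms in the presented group\<close>

text \<open>Conjugation by \<open>z\<close> carries \<open>x\<close> to \<open>y\<close>, hence
  powers to powers. It is applied to \<open>x = a\<close>, \<open>z = b\<close> and
  \<open>y = a^r\<close>.\<close>

lemma (in group) int_pow_commute_twisted:
  assumes [simp]: "x \<in> carrier G" "y \<in> carrier G" "z \<in> carrier G" and xz: "x \<otimes> z = z \<otimes> y"
  shows "x [^] (i :: int) \<otimes> z = z \<otimes> y [^] i"
proof -
  have nat: "x [^] k \<otimes> z = z \<otimes> y [^] k" for k :: nat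
  proof (induction k)
    case (Suc k)
    have "x [^] Suc k \<otimes> z = x [^] k \<otimes> (z \<otimes> y)"
      by (simp add: m_assoc xz)
    also have "\<dots> = z \<otimes> y [^] Suc k"
      using Suc by (simp flip: m_assoc)
    finally show ?case .
  qed simp
  show ?thesis
  proof (cases i rule: int_cases2)
    case (nonneg k)
    then show ?thesis using nat by (simp add: int_pow_int)
  next
    case (nonpos k)
    have "inv (x [^] k) \<otimes> (z \<otimes> y [^] k) \<otimes> inv (y [^] k) = z \<otimes> inv (y [^] k)"
      unfolding nat[symmetric] by (simp flip: m_assoc)
    then show ?thesis
      using nonpos by (simp add: int_pow_neg int_pow_int m_assoc)
  qed
qed

section \<open>Evaluation of words in the semidirect product\<close>

text \<open>The semidirect product law on unreduced exponents; reduction modulo \<open>n\<close> and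
  \<open>m\<close> is left to \<open>zm_cong\<close>.\<close>

definition zm_mult :: "int \<Rightarrow> nat \<times> int \<Rightarrow> nat \<times> int \<Rightarrow> nat \<times> int" where
  "zm_mult r p q = (fst p + fst q, snd p * r ^ fst q + snd q)"

text \<open>
  The letter \<open>b\<^sup>-\<^sup>1\<close> is read as \<open>b\<close> to the power \<open>n - 1\<close>, which keeps the exponents of \<open>r\<close> nonnegative.
\<close>

fun zm_letter :: "nat \<Rightarrow> zm_gen \<times> bool \<Rightarrow> nat \<times> int" where
  "zm_letter n (Gen_a, e) = (0, if e then 1 else - 1)"
| "zm_letter n (Gen_b, e) = (if e then 1 else n - 1, 0)"

definition zm_eval :: "nat \<Rightarrow> int \<Rightarrow> zm_gen word \<Rightarrow> nat \<times> int" where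
  "zm_eval n r w = foldr (\<lambda>x. zm_mult r (zm_letter n x)) w (0, 0)"

lemma zm_eval_simps [simp]:
  "zm_eval n r [] = (0, 0)"
  "zm_eval n r (x # w) = zm_mult r (zm_letter n x) (zm_eval n r w)"
  by (simp_all add: zm_eval_def)

lemma zm_eval_append: "zm_eval n r (u @ v) = zm_mult r (zm_eval n r u) (zm_eval n r v)"
  by (induction u) (simp_all add: zm_mult_def algebra_simps power_add)

lemma zm_eval_gen_pow:
  "zm_eval n r (gen_pow Gen_a i) = (0, i)"
  "zm_eval n r (gen_pow Gen_b (int j)) = (j, 0)"
proof -
  have a: "zm_eval n r (replicate k (Gen_a, e)) = (0, if e then int k else - int k)" for k e
    by (induction k) (auto simp: zm_mult_def)
  have b: "zm_eval n r (replicate k (Gen_b, True)) = (k, 0)" for k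
    by (induction k) (auto simp: zm_mult_def)
  show "zm_eval n r (gen_pow Gen_a i) = (0, i)"
    by (auto simp: gen_pow_def a)
  show "zm_eval n r (gen_pow Gen_b (int j)) = (j, 0)"
    by (auto simp: gen_pow_def b)
qed

definition zm_cong :: "nat \<Rightarrow> nat \<Rightarrow> nat \<times> int \<Rightarrow> nat \<times> int \<Rightarrow> bool" where
  "zm_cong m n p q \<longleftrightarrow> [fst p = fst q] (mod n) \<and> [snd p = snd q] (mod int m)"

lemma zm_cong_mult:
  assumes "[r ^ n = 1] (mod int m)" "zm_cong m n p p'" "zm_cong m n q q'"
  shows "zm_cong m n (zm_mult r p q) (zm_mult r p' q')"
  using assms by (auto simp: zm_cong_def zm_mult_def intro!: cong_add cong_mult cong_power_exponent[OF assms(1)])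

definition zm_rels :: "nat \<Rightarrow> nat \<Rightarrow> int \<Rightarrow> (zm_gen word \<times> zm_gen word) set" where
  "zm_rels m n r =
    {(gen_pow Gen_a (int m), []),
     (gen_pow Gen_b (int n), []),
     (gen_pow Gen_b (- 1) @ gen_pow Gen_a 1 @ gen_pow Gen_b 1, gen_pow Gen_a r)}"

lemma ZM_eq: "ZM m n r = presented_group (zm_rels m n r)"
  by (simp add: ZM_def zm_rels_def)

text \<open>The defining relations hold in the semidirect product, so evaluation is an invariant of
  group elements. This is what keeps distinct normal forms apart.\<close>

lemma zm_cong_eval:
  assumes n: "n \<ge> 1" and r: "[r ^ n = 1] (mod int m)"
    and uv: "(u, v) \<in> pres_rel (zm_rels m n r)"
  shows "zm_cong m n (zm_eval n r u) (zm_eval n r v)"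
proof -
  have embed: "zm_cong m n (zm_eval n r (u @ s @ v)) (zm_eval n r (u @ t @ v))"
    if "zm_cong m n (zm_eval n r s) (zm_eval n r t)" for u s t v
    unfolding zm_eval_append by (intro zm_cong_mult r that) (auto simp: zm_cong_def)
  show ?thesis
    using uv
  proof induction
    case (pres_refl u)
    show ?case by (simp add: zm_cong_def)
  next
    case (pres_sym u v)
    then show ?case by (simp add: zm_cong_def cong_sym_eq)
  next
    case (pres_trans u v w)
    then show ?case by (auto simp: zm_cong_def intro: cong_trans)
  next
    case (pres_cancel u x e v)
    \<comment> \<open>For the generator \<open>b\<close> the exponents add up to
      \<open>1 + (n - 1) = n\<close>, which is 0 modulo \<open>n\<close>; here \<open>n\<close> must
      be positive.\<close>
    have "zm_cong m n (zm_eval n r [(x, e), (x, \<not> e)]) (zm_eval n r [])"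
      using n by (cases x) (auto simp: zm_cong_def zm_mult_def cong_0_iff)
    from embed[OF this] show ?case by simp
  next
    case (pres_eqn s t u v)
    have "zm_cong m n (zm_eval n r s) (zm_eval n r t)"
    proof -
      have "zm_eval n r (gen_pow Gen_b (- 1) @ gen_pow Gen_a 1 @ gen_pow Gen_b 1) = (n, r)"
        using n by (simp add: gen_pow_def zm_mult_def)
      then show ?thesis
        using pres_eqn by (auto simp: zm_rels_def zm_cong_def zm_eval_gen_pow zm_eval_gen_pow(2)[of n r] cong_0_iff simp del: of_nat_0)
    qed
    then show ?case by (rule embed)
  qed
qed

section \<open>Calculation with the generators of the presented group\<close>

context
  fixes m n :: nat and r :: int
begin

definition zm_class :: "zm_gen word \<Rightarrow> zm_gen word set" where
  "zm_class w = pres_rel (zm_rels m n r) `` {w}"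

definition zm_elem :: "nat \<Rightarrow> int \<Rightarrow> zm_gen word set" where
  "zm_elem j i = zm_class (gen_pow Gen_b (int j) @ gen_pow Gen_a i)"

lemma zm_class_eq_iff: "zm_class u = zm_class v \<longleftrightarrow> (u, v) \<in> pres_rel (zm_rels m n r)"
  unfolding zm_class_def by (rule eq_equiv_class_iff[OF equiv_pres_rel]) auto

interpretation G: group "ZM m n r"
  unfolding ZM_eq by (rule group_presented_group)

lemma zm_class_append: "zm_class (u @ v) = zm_class u \<otimes>\<^bsub>ZM m n r\<^esub> zm_class v"
  by (simp add: zm_class_def ZM_eq presented_group_mult)

lemma zm_class_Nil: "zm_class [] = \<one>\<^bsub>ZM m n r\<^esub>"
  by (simp add: zm_class_def ZM_eq presented_group_def)

lemma zm_class_closed [simp]: "zm_class u \<in> carrier (ZM m n r)"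
  by (simp add: zm_class_def ZM_eq presented_group_def quotientI)

lemma carrier_ZM: "carrier (ZM m n r) = range zm_class"
  by (auto simp: zm_class_def ZM_eq presented_group_def quotient_def)

lemma zm_class_inv: "zm_class [(x, False)] = inv\<^bsub>ZM m n r\<^esub> zm_class [(x, True)]"
proof (rule G.inv_equality[symmetric])
  have "zm_class ([(x, False)] @ [(x, True)]) = zm_class []"
    using pres_cancel[of "[]" x False "[]"] by (simp add: zm_class_eq_iff)
  then show "zm_class [(x, False)] \<otimes>\<^bsub>ZM m n r\<^esub> zm_class [(x, True)] = \<one>\<^bsub>ZM m n r\<^esub>"
    by (simp only: zm_class_append zm_class_Nil)
qed auto

lemma zm_class_gen_pow: "zm_class (gen_pow x k) = zm_class [(x, True)] [^]\<^bsub>ZM m n r\<^esub> k"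
proof -
  have rep: "zm_class (replicate l y) = zm_class [y] [^]\<^bsub>ZM m n r\<^esub> l" for l y
  proof (induction l)
    case (Suc l)
    have "zm_class (replicate (Suc l) y) = zm_class (replicate l y @ [y])"
      by (simp only: replicate_Suc replicate_append_same)
    then show ?case by (simp only: zm_class_append Suc G.nat_pow_Suc)
  qed (simp add: zm_class_Nil)
  show ?thesis
    unfolding int_pow_def2 by (simp add: gen_pow_def rep zm_class_inv G.int_pow_inv)
qed

lemma zm_rels_eq: "(u, v) \<in> zm_rels m n r \<Longrightarrow> zm_class u = zm_class v"
  using pres_eqn[of u v "zm_rels m n r" "[]" "[]"] by (simp add: zm_class_eq_iff)

abbreviation "ZM_a \<equiv> zm_class [(Gen_a, True)]"
abbreviation "ZM_b \<equiv> zm_class [(Gen_b, True)]"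

lemma ZM_a_pow: "ZM_a [^]\<^bsub>ZM m n r\<^esub> int m = \<one>\<^bsub>ZM m n r\<^esub>"
  unfolding zm_class_gen_pow[symmetric] zm_class_Nil[symmetric]
  by (rule zm_rels_eq) (simp add: zm_rels_def)

lemma ZM_b_pow: "ZM_b [^]\<^bsub>ZM m n r\<^esub> n = \<one>\<^bsub>ZM m n r\<^esub>"
proof -
  have "ZM_b [^]\<^bsub>ZM m n r\<^esub> int n = \<one>\<^bsub>ZM m n r\<^esub>"
    unfolding zm_class_gen_pow[symmetric] zm_class_Nil[symmetric]
    by (rule zm_rels_eq) (simp add: zm_rels_def)
  then show ?thesis by (simp add: int_pow_int)
qed

lemma ZM_a_mult_b: "ZM_a \<otimes>\<^bsub>ZM m n r\<^esub> ZM_b = ZM_b \<otimes>\<^bsub>ZM m n r\<^esub> ZM_a [^]\<^bsub>ZM m n r\<^esub> r"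
proof -
  have "zm_class (gen_pow Gen_b (- 1) @ gen_pow Gen_a 1 @ gen_pow Gen_b 1) = zm_class (gen_pow Gen_a r)"
    by (rule zm_rels_eq) (simp add: zm_rels_def)
  then have "inv\<^bsub>ZM m n r\<^esub> ZM_b \<otimes>\<^bsub>ZM m n r\<^esub> (ZM_a \<otimes>\<^bsub>ZM m n r\<^esub> ZM_b) = ZM_a [^]\<^bsub>ZM m n r\<^esub> r"
    by (simp only: zm_class_append zm_class_gen_pow G.int_pow_neg G.int_pow_1 zm_class_closed)
  then show ?thesis
    by (simp add: G.inv_solve_left')
qed

text \<open>Each \<open>b\<close> that moves to the left past a power of \<open>a\<close> multiplies
  the exponent of \<open>a\<close> by \<open>r\<close>.\<close>

lemma ZM_a_pow_b_pow:
  "ZM_a [^]\<^bsub>ZM m n r\<^esub> (i :: int) \<otimes>\<^bsub>ZM m n r\<^esub> ZM_b [^]\<^bsub>ZM m n r\<^esub> (j :: nat) =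
    ZM_b [^]\<^bsub>ZM m n r\<^esub> j \<otimes>\<^bsub>ZM m n r\<^esub> ZM_a [^]\<^bsub>ZM m n r\<^esub> (i * r ^ j)"
proof (induction j arbitrary: i)
  case (Suc j)
  have conj_pow: "ZM_a [^]\<^bsub>ZM m n r\<^esub> k \<otimes>\<^bsub>ZM m n r\<^esub> ZM_b = ZM_b \<otimes>\<^bsub>ZM m n r\<^esub> ZM_a [^]\<^bsub>ZM m n r\<^esub> (k * r)" for k :: int
    using G.int_pow_commute_twisted[OF _ _ _ ZM_a_mult_b, of k] by (simp add: G.int_pow_pow mult.commute)
  have "ZM_a [^]\<^bsub>ZM m n r\<^esub> i \<otimes>\<^bsub>ZM m n r\<^esub> ZM_b [^]\<^bsub>ZM m n r\<^esub> Suc j =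
      ZM_b [^]\<^bsub>ZM m n r\<^esub> j \<otimes>\<^bsub>ZM m n r\<^esub> (ZM_a [^]\<^bsub>ZM m n r\<^esub> (i * r ^ j) \<otimes>\<^bsub>ZM m n r\<^esub> ZM_b)"
    by (simp add: Suc flip: G.m_assoc)
  also have "\<dots> = ZM_b [^]\<^bsub>ZM m n r\<^esub> Suc j \<otimes>\<^bsub>ZM m n r\<^esub> ZM_a [^]\<^bsub>ZM m n r\<^esub> (i * r ^ Suc j)"
    by (simp add: conj_pow G.m_assoc mult_ac)
  finally show ?case .
qed simp

lemma zm_elem_eq: "zm_elem j i = ZM_b [^]\<^bsub>ZM m n r\<^esub> j \<otimes>\<^bsub>ZM m n r\<^esub> ZM_a [^]\<^bsub>ZM m n r\<^esub> i"
  by (simp add: zm_elem_def zm_class_append zm_class_gen_pow int_pow_int)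

lemma zm_elem_mult:
  "zm_elem j i \<otimes>\<^bsub>ZM m n r\<^esub> zm_elem l k = zm_elem (j + l) (i * r ^ l + k)"
proof -
  have "zm_elem j i \<otimes>\<^bsub>ZM m n r\<^esub> zm_elem l k = ZM_b [^]\<^bsub>ZM m n r\<^esub> j \<otimes>\<^bsub>ZM m n r\<^esub>
      (ZM_a [^]\<^bsub>ZM m n r\<^esub> i \<otimes>\<^bsub>ZM m n r\<^esub> ZM_b [^]\<^bsub>ZM m n r\<^esub> l) \<otimes>\<^bsub>ZM m n r\<^esub> ZM_a [^]\<^bsub>ZM m n r\<^esub> k"
    by (simp add: zm_elem_eq G.m_assoc)
  also have "\<dots> = zm_elem (j + l) (i * r ^ l + k)"
    unfolding ZM_a_pow_b_pow by (simp add: zm_elem_eq G.m_assoc G.int_pow_mult flip: G.nat_pow_mult)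
  finally show ?thesis .
qed

text \<open>Normal forms multiply by \<open>zm_mult\<close>, so the letters can be absorbed one by
  one. Thus every element of the group has a normal form.\<close>

lemma zm_class_eq_elem:
  assumes "n \<ge> 1"
  shows "zm_class w = zm_elem (fst (zm_eval n r w)) (snd (zm_eval n r w))"
proof (induction w)
  case Nil
  show ?case by (simp add: zm_class_Nil zm_elem_eq)
next
  case (Cons y w)
  have "zm_class [y] = zm_elem (fst (zm_letter n y)) (snd (zm_letter n y))"
  proof -
    obtain x e where y: "y = (x, e)" by fastforce
    \<comment> \<open>This matches the value \<open>n - 1\<close> that \<open>zm_letter\<close>
      assigns to the inverse of \<open>b\<close>.\<close>
    have B_inv: "inv\<^bsub>ZM m n r\<^esub> ZM_b = ZM_b [^]\<^bsub>ZM m n r\<^esub> (n - 1)"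
      using assms ZM_b_pow by (intro G.inv_equality) (auto simp flip: G.nat_pow_Suc)
    show ?thesis
      by (cases x; cases e) (simp_all add: y zm_elem_eq zm_class_inv B_inv G.int_pow_neg)
  qed
  then show ?case
    using zm_class_append[of "[y]" w] by (simp add: Cons zm_elem_mult zm_mult_def)
qed

text \<open>Equal elements have congruent exponents by the invariance of \<open>zm_eval\<close>;
  conversely, the relations \<open>a^m = 1\<close> and \<open>b^n = 1\<close> absorb multiples of
  the moduli.\<close>

lemma zm_elem_eq_iff:
  assumes n: "n \<ge> 1" and r: "[r ^ n = 1] (mod int m)"
  shows "zm_elem j i = zm_elem l k \<longleftrightarrow> [j = l] (mod n) \<and> [i = k] (mod int m)"
proof
  assume "zm_elem j i = zm_elem l k"
  then have "zm_cong m n (zm_eval n r (gen_pow Gen_b (int j) @ gen_pow Gen_a i))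
      (zm_eval n r (gen_pow Gen_b (int l) @ gen_pow Gen_a k))"
    unfolding zm_elem_def zm_class_eq_iff by (rule zm_cong_eval[OF n r])
  then show "[j = l] (mod n) \<and> [i = k] (mod int m)"
    by (simp add: zm_eval_append zm_eval_gen_pow zm_mult_def zm_cong_def)
next
  assume jl: "[j = l] (mod n) \<and> [i = k] (mod int m)"
  have ZM_b_mod: "ZM_b [^]\<^bsub>ZM m n r\<^esub> x = ZM_b [^]\<^bsub>ZM m n r\<^esub> (x mod n)" for x
  proof -
    have "ZM_b [^]\<^bsub>ZM m n r\<^esub> (n * (x div n) + x mod n) = ZM_b [^]\<^bsub>ZM m n r\<^esub> (x mod n)"
      by (simp only: ZM_b_pow G.nat_pow_one G.l_one G.nat_pow_closed zm_class_closed
          G.nat_pow_mult[symmetric] G.nat_pow_pow[symmetric])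
    then show ?thesis by simp
  qed
  obtain c where "k = i + int m * c"
    using jl by (auto simp: cong_iff_lin)
  then have "ZM_a [^]\<^bsub>ZM m n r\<^esub> k = ZM_a [^]\<^bsub>ZM m n r\<^esub> i"
    by (simp add: G.int_pow_mult ZM_a_pow flip: G.int_pow_pow)
  then show "zm_elem j i = zm_elem l k"
    using jl ZM_b_mod[of j] ZM_b_mod[of l] by (simp add: zm_elem_eq cong_def)
qed

end

lemma zm_group_ZM:
  assumes "m \<ge> 1" "n \<ge> 1" "coprime m n" "[r ^ n = 1] (mod int m)"
  shows "zm_group (ZM m n r) m n r (zm_elem m n r)"
proof (intro zm_group.intro zm_group_axioms.intro)
  show "group (ZM m n r)"
    by (simp add: ZM_eq group_presented_group)
  show "carrier (ZM m n r) = {zm_elem m n r j i | j i. True}"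
  proof (intro equalityI subsetI)
    fix x assume "x \<in> carrier (ZM m n r)"
    then show "x \<in> {zm_elem m n r j i | j i. True}"
      using zm_class_eq_elem[OF assms(2)] by (auto simp: carrier_ZM)
  qed (auto simp: zm_elem_def)
qed (use assms in \<open>simp_all add: zm_elem_eq_iff zm_elem_mult\<close>)

theorem theorem4:
  fixes m n :: nat and r :: int
  assumes "m \<ge> 1" and "n \<ge> 1"
    and "gcd m n = 1" and "gcd (int m) (r - 1) = 1"
    and "[r ^ n = 1] (mod (int m))"
  shows "chain\<^sub>\<subseteq> (normal_subgroups (ZM m n r)) \<longleftrightarrow>
    (m = 1 \<and> is_prime_power n) \<or>
    (is_prime_power m \<and> is_prime_power n \<and>
      (\<forall>k::nat. 1 \<le> k \<and> k < n \<longrightarrow> gcd (int m) (r ^ k - 1) = 1))"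
proof -
  interpret zm_group "ZM m n r" m n r "zm_elem m n r"
    using assms by (intro zm_group_ZM) (auto simp: coprime_iff_gcd_eq_1)
  \<comment> \<open>This lets case (i) go through \<open>chain_if_prime_powers\<close> as well: 1 is
    a prime power and coprime to every integer.\<close>
  have one: "is_prime_power 1"
    unfolding is_prime_power_def by (metis power_0 two_is_prime_nat)
  show ?thesis
  proof
    assume "chain\<^sub>\<subseteq> (normal_subgroups (ZM m n r))"
    then show "(m = 1 \<and> is_prime_power n) \<or>
        (is_prime_power m \<and> is_prime_power n \<and>
          (\<forall>k::nat. 1 \<le> k \<and> k < n \<longrightarrow> gcd (int m) (r ^ k - 1) = 1))"
      using prime_powers_if_chain coprime_if_chain by simp
  next
    assume "(m = 1 \<and> is_prime_power n) \<or>
        (is_prime_power m \<and> is_prime_power n \<and>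
          (\<forall>k::nat. 1 \<le> k \<and> k < n \<longrightarrow> gcd (int m) (r ^ k - 1) = 1))"
    then show "chain\<^sub>\<subseteq> (normal_subgroups (ZM m n r))"
      using one by (intro chain_if_prime_powers) (auto simp: coprime_iff_gcd_eq_1)
  qed
qed

end
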